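(* Let $G$ be a graph with $m\ge 1$ edges and spectral radius $\lambda$. Then $$t(G)\ge m\bigl(\lambda-\sqrt m\,\bigr),$$ with equality if and only if $G$ is a complete bipartite graph (up to isolated vertices).
   Context: Graphs are finite and simple. The spectral radius $\lambda=\lambda(G)$ is the largest eigenvalue of the adjacency matrix of $G$, and $t(G)$ is the number of triangles of $G$. Isolated vertices are ignored in all extremal and equality statements. *)

theory Defs
  imports
    "Graph_Theory.Kuratowski"
    "Jordan_Normal_Form.Spectral_Radius"
begin

text \<open>
  The locale \<^locale>\<open>graph\<close> represents a finite simple graph by a symmetric, loop-free
  digraph without parallel arcs: an undirected edge corresponds to two opposite arcs.
\<close>

definition edges :: "('a, 'b) pre_digraph \<Rightarrow> 'a set set" where
  "edges G = {{u, v} | u v. u \<rightarrow>\<^bsub>G\<^esub> v}"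

definition triangles :: "('a, 'b) pre_digraph \<Rightarrow> 'a set set" where
  "triangles G = {{u, v, w} | u v w. u \<rightarrow>\<^bsub>G\<^esub> v \<and> v \<rightarrow>\<^bsub>G\<^esub> w \<and> u \<rightarrow>\<^bsub>G\<^esub> w}"

text \<open>
  The list \<open>vs\<close> is an enumeration of the vertices, which indexes the rows and columns.
\<close>

definition adjacency_matrix :: "('a, 'b) pre_digraph \<Rightarrow> 'a list \<Rightarrow> real mat" where
  "adjacency_matrix G vs =
     mat (length vs) (length vs) (\<lambda>(i, j). if vs ! i \<rightarrow>\<^bsub>G\<^esub> vs ! j then 1 else 0)"

text \<open>
  The constant \<^const>\<open>spectral_radius\<close> is the maximum modulus of the eigenvalues of a
  complex matrix; here the largest (real) eigenvalue is needed.
\<close>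

definition largest_eigenvalue :: "real mat \<Rightarrow> real" where
  "largest_eigenvalue A = Max (spectrum A)"

definition delete_isolated :: "('a, 'b) pre_digraph \<Rightarrow> ('a, 'b) pre_digraph" where
  "delete_isolated G = G \<restriction> {v \<in> verts G. \<exists>u. v \<rightarrow>\<^bsub>G\<^esub> u}"

definition complete_bipartite_up_to_isolated :: "('a, 'b) pre_digraph \<Rightarrow> bool" where
  "complete_bipartite_up_to_isolated G \<longleftrightarrow>
     (\<exists>p q. p \<ge> 1 \<and> q \<ge> 1 \<and> K\<^bsub>p,q\<^esub> (delete_isolated G))"

end

theory Submission
  imports Defs "HOL-Analysis.Convex"
begin

text \<open>
  Write \<open>A\<close> for the adjacency matrix, \<open>m\<close> for the number of edges and \<open>t\<close> for the number of
  triangles. Then \<open>A\<close> has squared Frobenius norm \<open>2 m\<close>, and the trace of its cube is \<open>6 t\<close>.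
  Let \<open>x\<close> be a unit eigenvector for the largest eigenvalue \<open>lam\<close> and remove its contribution:
  \<open>B = A - lam x x\<^sup>T\<close> has squared Frobenius norm \<open>s\<^sup>2 = 2 m - lam\<^sup>2\<close>, and the trace of its cube
  is \<open>6 t - lam\<^sup>3\<close>. Cauchy-Schwarz bounds that trace below by \<open>- s\<^sup>3\<close>, so
  \<open>6 t \<ge> lam\<^sup>3 - s\<^sup>3\<close> (\<open>cube_trace_lower_bound\<close>). If \<open>lam < 0\<close>, the claimed bound is negative.
  Otherwise \<open>lam\<close> and \<open>s\<close> are nonnegative with \<open>lam\<^sup>2 + s\<^sup>2 = 2 m\<close>, and the elementary
  inequality \<open>cubic_tangent\<close> gives \<open>lam\<^sup>3 - s\<^sup>3 \<ge> 6 m (lam - sqrt m)\<close>, with equality only for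
  \<open>lam = s\<close>. The largest eigenvalue exists because the characteristic polynomial has a complex root
  and the symmetry of \<open>A\<close> makes it real (\<open>symmetric_eigenvalue_exists\<close>).

  Equality forces \<open>lam = s = sqrt m\<close>, hence \<open>t = 0\<close>, and equality in Cauchy-Schwarz, which reads
  \<open>B\<^sup>2 = - lam B\<close> and gives \<open>A\<^sup>3 = m A\<close> (\<open>cube_of_extremal\<close>). An entry of \<open>A\<^sup>3\<close> counts walks
  of length three, so between the ends of an edge \<open>ij\<close> there are exactly \<open>m\<close> of them. As there are
  no triangles, each edge is the middle of such a walk in at most one direction, so every edge joins
  the neighbourhoods of \<open>i\<close> and \<open>j\<close>; and any two vertices of these neighbourhoods are joined by the
  walk through \<open>ij\<close>, hence adjacent, because \<open>A\<^sup>3\<close> and \<open>A\<close> have the same support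
  (\<open>complete_bipartite_of_cube\<close>).

  Conversely, a complete bipartite graph has no triangles and has \<open>sqrt m\<close> as an eigenvalue
  (\<open>complete_bipartite_extremal\<close>), so the bound is at least \<open>0 = t\<close> and must be attained.
\<close>

section \<open>Frobenius norms and traces of cubes\<close>

text \<open>
  Matrices are functions of two indices restricted to a finite index set \<open>V\<close>; vertices then
  serve as indices themselves. For symmetric \<open>b\<close> the trace of the cube is
  \<open>hs_inner V (kmult V b b) b\<close>.
\<close>

definition kmult :: "'a set \<Rightarrow> ('a \<Rightarrow> 'a \<Rightarrow> real) \<Rightarrow> ('a \<Rightarrow> 'a \<Rightarrow> real) \<Rightarrow> 'a \<Rightarrow> 'a \<Rightarrow> real" where
  "kmult V a b u w = (\<Sum>v\<in>V. a u v * b v w)"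

definition hs_inner :: "'a set \<Rightarrow> ('a \<Rightarrow> 'a \<Rightarrow> real) \<Rightarrow> ('a \<Rightarrow> 'a \<Rightarrow> real) \<Rightarrow> real" where
  "hs_inner V a b = (\<Sum>u\<in>V. \<Sum>w\<in>V. a u w * b u w)"

lemma hs_inner_self_nonneg: "0 \<le> hs_inner V a a"
  by (simp add: hs_inner_def sum_nonneg)

lemma hs_inner_self_eq_0_iff:
  assumes "finite V"
  shows "hs_inner V a a = 0 \<longleftrightarrow> (\<forall>u\<in>V. \<forall>w\<in>V. a u w = 0)"
  using assms by (simp add: hs_inner_def sum_nonneg_eq_0_iff sum_nonneg)

lemma hs_inner_kmult_le:
  "hs_inner V (kmult V a b) (kmult V a b) \<le> hs_inner V a a * hs_inner V b b"
proof -
  have "hs_inner V (kmult V a b) (kmult V a b)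
      \<le> (\<Sum>u\<in>V. \<Sum>w\<in>V. (\<Sum>v\<in>V. (a u v)\<^sup>2) * (\<Sum>v\<in>V. (b v w)\<^sup>2))"
    unfolding hs_inner_def kmult_def
    by (intro sum_mono) (simp add: Cauchy_Schwarz_ineq_sum flip: power2_eq_square)
  also have "\<dots> = (\<Sum>u\<in>V. \<Sum>v\<in>V. (a u v)\<^sup>2) * (\<Sum>w\<in>V. \<Sum>v\<in>V. (b v w)\<^sup>2)"
    by (simp add: sum_product)
  also have "(\<Sum>w\<in>V. \<Sum>v\<in>V. (b v w)\<^sup>2) = (\<Sum>v\<in>V. \<Sum>w\<in>V. (b v w)\<^sup>2)"
    by (rule sum.swap)
  finally show ?thesis
    by (simp add: hs_inner_def power2_eq_square)
qed

lemma hs_inner_square_plus_scale: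
  "hs_inner V (\<lambda>u w. c u w + s * b u w) (\<lambda>u w. c u w + s * b u w)
     = hs_inner V c c + 2 * s * hs_inner V c b + s\<^sup>2 * hs_inner V b b"
proof -
  have "(c u w + s * b u w) * (c u w + s * b u w)
      = c u w * c u w + 2 * s * (c u w * b u w) + s\<^sup>2 * (b u w * b u w)" for u w
    by (simp add: algebra_simps power2_eq_square)
  then show ?thesis
    by (simp add: hs_inner_def sum.distrib sum_distrib_left)
qed

text \<open>
  Both parts come from expanding the squared Frobenius norm of \<open>b\<^sup>2 + s b\<close>. Submultiplicativity
  bounds it above by \<open>2 s\<close> times the sum of the trace of \<open>b\<^sup>3\<close> and \<open>s\<^sup>3\<close>, so this sum is
  nonnegative, and if it is zero then \<open>b\<^sup>2 + s b\<close> vanishes.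
\<close>

lemma cube_trace_ge:
  assumes "finite V" and "0 \<le> s" and s: "s\<^sup>2 = hs_inner V b b"
  shows "- (s ^ 3) \<le> hs_inner V (kmult V b b) b"
    and "hs_inner V (kmult V b b) b = - (s ^ 3) \<Longrightarrow>
         \<forall>u\<in>V. \<forall>w\<in>V. kmult V b b u w = - s * b u w"
proof -
  let ?c = "kmult V b b" and ?d = "\<lambda>u w. kmult V b b u w + s * b u w"
  have "hs_inner V ?c ?c \<le> s\<^sup>2 * s\<^sup>2"
    using hs_inner_kmult_le[of V b b] by (simp add: s)
  then have "hs_inner V ?d ?d \<le> s\<^sup>2 * s\<^sup>2 + 2 * s * hs_inner V ?c b + s\<^sup>2 * s\<^sup>2"
    unfolding hs_inner_square_plus_scale s by simp
  then have le: "hs_inner V ?d ?d \<le> 2 * s * (hs_inner V ?c b + s ^ 3)"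
    by (simp add: algebra_simps eval_nat_numeral)
  have nn: "0 \<le> hs_inner V ?d ?d"
    by (rule hs_inner_self_nonneg)
  show "- (s ^ 3) \<le> hs_inner V ?c b"
  proof (cases "s = 0")
    case True
    then have "\<forall>u\<in>V. \<forall>w\<in>V. b u w = 0"
      using s assms(1) by (simp add: hs_inner_self_eq_0_iff)
    then have "hs_inner V ?c b = 0"
      by (simp add: hs_inner_def)
    with True show ?thesis by simp
  next
    case False
    with \<open>0 \<le> s\<close> have "0 < 2 * s" by simp
    moreover have "0 \<le> 2 * s * (hs_inner V ?c b + s ^ 3)"
      using le nn by linarith
    ultimately have "0 \<le> hs_inner V ?c b + s ^ 3"
      by (simp only: zero_le_mult_iff) linarith
    then show ?thesis by simp
  qed
  assume "hs_inner V ?c b = - (s ^ 3)"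
  with le nn have "hs_inner V ?d ?d = 0"
    by simp
  then have "\<forall>u\<in>V. \<forall>w\<in>V. ?d u w = 0"
    using assms(1) by (simp only: hs_inner_self_eq_0_iff)
  then show "\<forall>u\<in>V. \<forall>w\<in>V. ?c u w = - s * b u w"
    by (simp add: add_eq_0_iff2)
qed

section \<open>Deflation by a unit eigenvector\<close>

locale unit_eigenvector =
  fixes V :: "'a set" and a :: "'a \<Rightarrow> 'a \<Rightarrow> real" and x :: "'a \<Rightarrow> real" and lam :: real
  assumes finite_V: "finite V"
    and sym: "\<And>u w. a u w = a w u"
    and eigen: "\<And>u. u \<in> V \<Longrightarrow> (\<Sum>w\<in>V. a u w * x w) = lam * x u"
    and unit: "(\<Sum>v\<in>V. (x v)\<^sup>2) = 1"
begin

definition deflated :: "'a \<Rightarrow> 'a \<Rightarrow> real" where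
  "deflated u w = a u w - lam * x u * x w"

lemma eigen_left: "w \<in> V \<Longrightarrow> (\<Sum>v\<in>V. x v * a v w) = lam * x w"
  using eigen[of w] by (simp add: sym[of _ w] mult.commute)

lemma kmult_eigen:
  assumes "u \<in> V"
  shows "(\<Sum>w\<in>V. kmult V a a u w * x w) = lam\<^sup>2 * x u"
proof -
  have "(\<Sum>w\<in>V. kmult V a a u w * x w) = (\<Sum>w\<in>V. \<Sum>v\<in>V. a u v * (a v w * x w))"
    by (simp add: kmult_def sum_distrib_right mult.assoc)
  also have "\<dots> = (\<Sum>v\<in>V. a u v * (\<Sum>w\<in>V. a v w * x w))"
    by (subst sum.swap) (simp add: sum_distrib_left)
  also have "\<dots> = lam * (\<Sum>v\<in>V. a u v * x v)"
    by (simp add: eigen sum_distrib_left mult.left_commute)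
  also have "\<dots> = lam\<^sup>2 * x u"
    using assms by (simp add: eigen power2_eq_square mult.assoc)
  finally show ?thesis .
qed

lemma kmult_deflated:
  assumes "u \<in> V" "w \<in> V"
  shows "kmult V deflated deflated u w = kmult V a a u w - lam\<^sup>2 * x u * x w"
proof -
  have "kmult V deflated deflated u w =
      (\<Sum>v\<in>V. a u v * a v w - lam * x w * (a u v * x v) - lam * x u * (x v * a v w)
         + lam\<^sup>2 * x u * x w * (x v)\<^sup>2)"
    unfolding kmult_def deflated_def by (intro sum.cong) (simp_all add: algebra_simps power2_eq_square)
  also have "\<dots> = kmult V a a u w - lam * x w * (\<Sum>v\<in>V. a u v * x v)
        - lam * x u * (\<Sum>v\<in>V. x v * a v w) + lam\<^sup>2 * x u * x w * (\<Sum>v\<in>V. (x v)\<^sup>2)"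
    by (simp add: kmult_def sum.distrib sum_subtractf sum_distrib_left)
  also have "\<dots> = kmult V a a u w - lam\<^sup>2 * x u * x w"
    unfolding eigen[OF assms(1)] eigen_left[OF assms(2)] unit
    by (simp add: algebra_simps power2_eq_square)
  finally show ?thesis .
qed

lemma hs_norm_deflated: "hs_inner V deflated deflated = hs_inner V a a - lam\<^sup>2"
proof -
  have "(\<Sum>w\<in>V. deflated u w * deflated u w) = (\<Sum>w\<in>V. a u w * a u w) - lam\<^sup>2 * (x u)\<^sup>2"
    if "u \<in> V" for u
  proof -
    have "(\<Sum>w\<in>V. deflated u w * deflated u w) =
        (\<Sum>w\<in>V. a u w * a u w - 2 * lam * x u * (a u w * x w) + lam\<^sup>2 * (x u)\<^sup>2 * (x w)\<^sup>2)"
      unfolding deflated_def by (intro sum.cong) (simp_all add: algebra_simps power2_eq_square)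
    also have "\<dots> = (\<Sum>w\<in>V. a u w * a u w) - 2 * lam * x u * (\<Sum>w\<in>V. a u w * x w)
        + lam\<^sup>2 * (x u)\<^sup>2 * (\<Sum>w\<in>V. (x w)\<^sup>2)"
      by (simp add: sum.distrib sum_subtractf sum_distrib_left)
    finally show ?thesis
      unfolding eigen[OF that] unit by (simp add: algebra_simps power2_eq_square)
  qed
  then have "hs_inner V deflated deflated = (\<Sum>u\<in>V. (\<Sum>w\<in>V. a u w * a u w) - lam\<^sup>2 * (x u)\<^sup>2)"
    by (simp add: hs_inner_def)
  also have "\<dots> = hs_inner V a a - lam\<^sup>2 * (\<Sum>u\<in>V. (x u)\<^sup>2)"
    by (simp add: hs_inner_def sum_subtractf sum_distrib_left)
  finally show ?thesis by (simp add: unit)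
qed

lemma cube_trace_deflated:
  "hs_inner V (kmult V deflated deflated) deflated = hs_inner V (kmult V a a) a - lam ^ 3"
proof -
  have "(\<Sum>w\<in>V. kmult V deflated deflated u w * deflated u w)
      = (\<Sum>w\<in>V. kmult V a a u w * a u w) - lam ^ 3 * (x u)\<^sup>2" if "u \<in> V" for u
  proof -
    have "(\<Sum>w\<in>V. kmult V deflated deflated u w * deflated u w) =
        (\<Sum>w\<in>V. kmult V a a u w * a u w - lam * x u * (kmult V a a u w * x w)
           - lam\<^sup>2 * x u * (a u w * x w) + lam ^ 3 * (x u)\<^sup>2 * (x w)\<^sup>2)"
      using that by (intro sum.cong)
        (simp_all add: kmult_deflated deflated_def algebra_simps power2_eq_square power3_eq_cube)
    also have "\<dots> = (\<Sum>w\<in>V. kmult V a a u w * a u w) - lam * x u * (\<Sum>w\<in>V. kmult V a a u w * x w)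
        - lam\<^sup>2 * x u * (\<Sum>w\<in>V. a u w * x w) + lam ^ 3 * (x u)\<^sup>2 * (\<Sum>w\<in>V. (x w)\<^sup>2)"
      by (simp add: sum.distrib sum_subtractf sum_distrib_left)
    finally show ?thesis
      unfolding eigen[OF that] kmult_eigen[OF that] unit
      by (simp add: algebra_simps power2_eq_square power3_eq_cube)
  qed
  then have "hs_inner V (kmult V deflated deflated) deflated =
      (\<Sum>u\<in>V. (\<Sum>w\<in>V. kmult V a a u w * a u w) - lam ^ 3 * (x u)\<^sup>2)"
    by (simp add: hs_inner_def)
  also have "\<dots> = hs_inner V (kmult V a a) a - lam ^ 3 * (\<Sum>u\<in>V. (x u)\<^sup>2)"
    by (simp add: hs_inner_def sum_subtractf sum_distrib_left)
  finally show ?thesis by (simp add: unit)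
qed

text \<open>
  In terms of the spectrum: \<open>s\<^sup>2\<close> is the sum of the squares of the other eigenvalues, and the sum of
  their cubes is smallest when a single one of them, equal to \<open>- s\<close>, is nonzero.
\<close>

lemma cube_trace_lower_bound:
  assumes "0 \<le> s" and s: "s\<^sup>2 = hs_inner V a a - lam\<^sup>2"
  shows "lam ^ 3 - s ^ 3 \<le> hs_inner V (kmult V a a) a"
  using cube_trace_ge(1)[OF finite_V, of s deflated] assms
  by (simp add: hs_norm_deflated cube_trace_deflated)

text \<open>
  Here \<open>cube_trace_lower_bound\<close> is attained with \<open>s = lam\<close>, so the only nonzero eigenvalues are
  \<open>lam\<close> and \<open>- lam\<close>. The proof stays with matrices: equality gives \<open>b\<^sup>2 = - lam b\<close>, that is
  \<open>a\<^sup>2 = 2 lam\<^sup>2 x x\<^sup>T - lam a\<close>, and multiplying by \<open>a\<close> cancels the rank-one terms.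
\<close>

lemma cube_of_extremal:
  assumes "0 \<le> lam" and norm: "hs_inner V a a = 2 * lam\<^sup>2"
    and trace: "hs_inner V (kmult V a a) a = 0"
    and "u \<in> V" "w \<in> V"
  shows "kmult V a (kmult V a a) u w = lam\<^sup>2 * a u w"
proof -
  have sq: "kmult V a a v w = 2 * lam\<^sup>2 * x w * x v - lam * a v w" if "v \<in> V" for v
  proof -
    have "kmult V deflated deflated v w = - lam * deflated v w"
      using cube_trace_ge(2)[OF finite_V, of lam deflated] assms that
      by (simp add: hs_norm_deflated cube_trace_deflated)
    then show ?thesis
      using that assms by (simp add: kmult_deflated deflated_def algebra_simps power2_eq_square)
  qed
  have "kmult V a (kmult V a a) u w =
      (\<Sum>v\<in>V. 2 * lam\<^sup>2 * x w * (a u v * x v) - lam * (a u v * a v w))"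
    unfolding kmult_def[of V a "kmult V a a"]
    by (intro sum.cong) (simp_all add: sq algebra_simps)
  also have "\<dots> = 2 * lam\<^sup>2 * x w * (\<Sum>v\<in>V. a u v * x v) - lam * kmult V a a u w"
    by (simp add: kmult_def sum_subtractf sum_distrib_left)
  also have "\<dots> = lam\<^sup>2 * a u w"
    unfolding eigen[OF \<open>u \<in> V\<close>] sq[OF \<open>u \<in> V\<close>]
    by (simp add: algebra_simps power2_eq_square)
  finally show ?thesis .
qed

end

section \<open>The scalar inequality\<close>

text \<open>
  On the circle \<open>y\<^sup>2 + s\<^sup>2 = 2 r\<^sup>2\<close>, regard \<open>y\<^sup>3 - s\<^sup>3\<close> as a function of \<open>y\<close>; the left side is its
  tangent at \<open>y = s = r\<close>. Using the circle to replace \<open>r\<^sup>2 y\<close>, the difference becomes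
  \<open>6 r\<^sup>3 - p\<close> with \<open>p\<close> free of \<open>r\<close>. Comparing squares removes the odd power of \<open>r\<close> and leaves a
  sextic form in \<open>y\<close> and \<open>s\<close>; tangency makes \<open>(y - s)\<^sup>2\<close> divide it, and the cofactor \<open>q\<close> has
  positive coefficients.
\<close>

lemma cubic_tangent:
  fixes y s r :: real
  assumes "0 \<le> y" "0 \<le> s" "0 < r" and r: "2 * r\<^sup>2 = y\<^sup>2 + s\<^sup>2"
  shows "6 * r\<^sup>2 * (y - r) \<le> y ^ 3 - s ^ 3"
    and "6 * r\<^sup>2 * (y - r) = y ^ 3 - s ^ 3 \<Longrightarrow> y = s"
proof -
  define p where "p = 2 * y ^ 3 + 3 * y * s\<^sup>2 + s ^ 3"
  define q where "q = y ^ 4 + 2 * y ^ 3 * s + 6 * y\<^sup>2 * s\<^sup>2 + 2 * y * s ^ 3 + 7 * s ^ 4"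
  have diff: "y ^ 3 - s ^ 3 - 6 * r\<^sup>2 * (y - r) = 6 * r ^ 3 - p"
  proof -
    have "6 * r\<^sup>2 * (y - r) = 3 * (2 * r\<^sup>2) * y - 6 * r ^ 3"
      by (simp add: algebra_simps power2_eq_square power3_eq_cube)
    then show ?thesis
      by (simp only: r p_def) (simp add: algebra_simps power2_eq_square power3_eq_cube)
  qed
  have "2 * ((6 * r ^ 3)\<^sup>2 - p\<^sup>2) = 9 * (2 * r\<^sup>2) ^ 3 - 2 * p\<^sup>2"
    by (simp add: power_mult_distrib flip: power_mult)
  also have "\<dots> = (y - s)\<^sup>2 * q"
    unfolding r p_def q_def by (simp add: algebra_simps eval_nat_numeral)
  finally have sq: "2 * ((6 * r ^ 3)\<^sup>2 - p\<^sup>2) = (y - s)\<^sup>2 * q" .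
  have "0 < q"
  proof (cases "y = 0")
    case True
    then have "s \<noteq> 0" using r \<open>0 < r\<close> by auto
    with \<open>0 \<le> s\<close> True show ?thesis by (simp add: q_def)
  next
    case False
    with \<open>0 \<le> y\<close> \<open>0 \<le> s\<close> show ?thesis
      unfolding q_def by (intro add_pos_nonneg mult_nonneg_nonneg) auto
  qed
  then have "0 \<le> (y - s)\<^sup>2 * q"
    by simp
  then have "p\<^sup>2 \<le> (6 * r ^ 3)\<^sup>2"
    unfolding sq[symmetric] by simp
  then have "p \<le> 6 * r ^ 3"
    by (rule power2_le_imp_le) (use \<open>0 < r\<close> in simp)
  then show "6 * r\<^sup>2 * (y - r) \<le> y ^ 3 - s ^ 3"
    using diff by simp
  assume "6 * r\<^sup>2 * (y - r) = y ^ 3 - s ^ 3"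
  then have "p = 6 * r ^ 3" using diff by simp
  then have "(y - s)\<^sup>2 * q = 0"
    unfolding sq[symmetric] by simp
  with \<open>0 < q\<close> show "y = s" by simp
qed
section \<open>Eigenvalues of symmetric matrices\<close>

text \<open>
  Passing from positions in the list \<open>vs\<close> to its entries; the field is left general because
  the lemma is applied to complex as well as to real matrices.
\<close>

lemma eigenvalue_indexed_mat_iff:
  fixes a :: "'a \<Rightarrow> 'a \<Rightarrow> 'k::field"
  assumes "distinct vs"
  shows "eigenvalue (mat (length vs) (length vs) (\<lambda>(i, j). a (vs ! i) (vs ! j))) c \<longleftrightarrow>
    (\<exists>x. (\<exists>v\<in>set vs. x v \<noteq> 0) \<and> (\<forall>u\<in>set vs. (\<Sum>w\<in>set vs. a u w * x w) = c * x u))"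
    (is "eigenvalue ?A c \<longleftrightarrow> ?R")
proof -
  let ?n = "length vs"
  have bij: "bij_betw ((!) vs) {..<?n} (set vs)"
    using assms by (rule bij_betw_nth) auto
  have row: "(?A *\<^sub>v v) $ i = (\<Sum>w\<in>set vs. a (vs ! i) w * x w)"
    if "v \<in> carrier_vec ?n" "i < ?n" "\<And>j. j < ?n \<Longrightarrow> v $ j = x (vs ! j)" for v x i
    using that sum.reindex_bij_betw[OF bij, of "\<lambda>w. a (vs ! i) w * x w"]
    by (simp add: scalar_prod_def atLeast0LessThan)
  show ?thesis
  proof
    assume "eigenvalue ?A c"
    then obtain v where v: "v \<in> carrier_vec ?n" "v \<noteq> 0\<^sub>v ?n" "?A *\<^sub>v v = c \<cdot>\<^sub>v v"
      by (auto simp: eigenvalue_def eigenvector_def)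
    define x where "x w = v $ the_inv_into {..<?n} ((!) vs) w" for w
    have x: "v $ j = x (vs ! j)" if "j < ?n" for j
      using the_inv_into_f_f[OF bij_betw_imp_inj_on[OF bij]] that by (simp add: x_def)
    have "\<exists>w\<in>set vs. x w \<noteq> 0"
    proof (rule ccontr)
      assume "\<not> (\<exists>w\<in>set vs. x w \<noteq> 0)"
      then have "v $ j = 0" if "j < ?n" for j
        using x[OF that] nth_mem[OF that] by simp
      then have "v = 0\<^sub>v ?n"
        using v(1) by (intro eq_vecI) auto
      with v(2) show False ..
    qed
    moreover have "(\<Sum>w\<in>set vs. a u w * x w) = c * x u" if "u \<in> set vs" for u
    proof -
      from that obtain i where i: "i < ?n" "u = vs ! i"
        by (auto simp: in_set_conv_nth)
      have "(\<Sum>w\<in>set vs. a u w * x w) = (?A *\<^sub>v v) $ i"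
        using row[OF v(1) i(1) x] by (simp only: i)
      also have "\<dots> = c * v $ i"
        using i(1) v(1) by (simp add: v(3))
      finally show ?thesis
        using x[OF i(1)] by (simp only: i)
    qed
    ultimately show ?R by blast
  next
    assume ?R
    then obtain x where x: "\<exists>w\<in>set vs. x w \<noteq> 0"
      and ev: "\<And>u. u \<in> set vs \<Longrightarrow> (\<Sum>w\<in>set vs. a u w * x w) = c * x u"
      by blast
    define v where "v = vec ?n (\<lambda>i. x (vs ! i))"
    obtain i where i: "i < ?n" "x (vs ! i) \<noteq> 0"
      using x by (auto simp: in_set_conv_nth)
    then have "v $ i \<noteq> 0\<^sub>v ?n $ i"
      by (simp add: v_def)
    then have "v \<noteq> 0\<^sub>v ?n"
      by auto
    moreover have "?A *\<^sub>v v = c \<cdot>\<^sub>v v"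
    proof (rule eq_vecI)
      fix i assume "i < dim_vec (c \<cdot>\<^sub>v v)"
      then have i: "i < ?n"
        by (simp add: v_def)
      have "(?A *\<^sub>v v) $ i = (\<Sum>w\<in>set vs. a (vs ! i) w * x w)"
        by (rule row) (simp_all add: v_def i)
      then show "(?A *\<^sub>v v) $ i = (c \<cdot>\<^sub>v v) $ i"
        using i by (simp only: ev nth_mem) (simp add: v_def)
    qed (simp add: v_def)
    ultimately show "eigenvalue ?A c"
      unfolding eigenvalue_def eigenvector_def by (intro exI[of _ v]) (simp add: v_def)
  qed
qed

text \<open>
  A complex eigenvector \<open>p + i q\<close> exists by the fundamental theorem of algebra. Evaluating the
  symmetric form at \<open>p\<close> and \<open>q\<close> in both orders shows that its eigenvalue is real, and then
  whichever of \<open>p\<close> and \<open>q\<close> is nonzero is a real eigenvector.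
\<close>

lemma symmetric_eigenvalue_exists:
  fixes a :: "'a \<Rightarrow> 'a \<Rightarrow> real"
  assumes "finite V" "V \<noteq> {}" and sym: "\<And>u w. a u w = a w u"
  obtains c x where "\<exists>v\<in>V. x v \<noteq> 0" "\<And>u. u \<in> V \<Longrightarrow> (\<Sum>w\<in>V. a u w * x w) = c * x u"
proof -
  obtain vs where vs: "distinct vs" "set vs = V"
    using finite_distinct_list[OF assms(1)] by blast
  then have "length vs > 0"
    using assms(2) by auto
  then have "spectrum (mat (length vs) (length vs) (\<lambda>(i, j). complex_of_real (a (vs ! i) (vs ! j)))) \<noteq> {}"
    by (rule spectrum_non_empty[OF mat_carrier])
  then obtain z where "eigenvalue (mat (length vs) (length vs)
      (\<lambda>(i, j). complex_of_real (a (vs ! i) (vs ! j)))) z"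
    unfolding spectrum_def by blast
  then obtain y where y: "\<exists>v\<in>V. y v \<noteq> 0"
    and ev: "\<And>u. u \<in> V \<Longrightarrow> (\<Sum>w\<in>V. complex_of_real (a u w) * y w) = z * y u"
    using eigenvalue_indexed_mat_iff[OF vs(1), of "\<lambda>u w. complex_of_real (a u w)" z] vs(2)
    by auto
  define p q where "p v = Re (y v)" and "q v = Im (y v)" for v
  have ev_p: "(\<Sum>w\<in>V. a u w * p w) = Re z * p u - Im z * q u" if "u \<in> V" for u
    using arg_cong[OF ev[OF that], of Re] by (simp add: p_def q_def)
  have ev_q: "(\<Sum>w\<in>V. a u w * q w) = Re z * q u + Im z * p u" if "u \<in> V" for u
    using arg_cong[OF ev[OF that], of Im] by (simp add: p_def q_def)
  have "(\<Sum>u\<in>V. q u * (\<Sum>w\<in>V. a u w * p w)) = (\<Sum>u\<in>V. \<Sum>w\<in>V. q u * a u w * p w)"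
    by (simp add: sum_distrib_left mult.assoc)
  also have "\<dots> = (\<Sum>w\<in>V. p w * (\<Sum>u\<in>V. a w u * q u))"
    by (subst sum.swap) (simp add: sum_distrib_left sym mult_ac)
  finally have "(\<Sum>u\<in>V. q u * (Re z * p u - Im z * q u)) = (\<Sum>u\<in>V. p u * (Re z * q u + Im z * p u))"
    by (simp add: ev_p ev_q)
  then have "(\<Sum>u\<in>V. p u * (Re z * q u + Im z * p u) - q u * (Re z * p u - Im z * q u)) = 0"
    by (simp add: sum_subtractf)
  also have "(\<Sum>u\<in>V. p u * (Re z * q u + Im z * p u) - q u * (Re z * p u - Im z * q u))
      = (\<Sum>u\<in>V. Im z * ((p u)\<^sup>2 + (q u)\<^sup>2))"
    by (intro sum.cong) (simp_all add: algebra_simps power2_eq_square)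
  finally have "Im z * (\<Sum>u\<in>V. (p u)\<^sup>2 + (q u)\<^sup>2) = 0"
    by (simp only: sum_distrib_left)
  moreover have "0 < (\<Sum>u\<in>V. (p u)\<^sup>2 + (q u)\<^sup>2)"
  proof -
    obtain v where "v \<in> V" "y v \<noteq> 0" using y by blast
    then have "0 < (p v)\<^sup>2 + (q v)\<^sup>2"
      by (simp add: p_def q_def complex_neq_0)
    then show ?thesis
      using \<open>v \<in> V\<close> assms(1) by (intro sum_pos2[of V v]) auto
  qed
  ultimately have [simp]: "Im z = 0"
    by (metis less_irrefl mult_eq_0_iff)
  have "(\<exists>v\<in>V. p v \<noteq> 0) \<or> (\<exists>v\<in>V. q v \<noteq> 0)"
    using y by (auto simp: p_def q_def complex_eq_iff)
  then show ?thesis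
    using that[of p "Re z"] that[of q "Re z"] ev_p ev_q by auto
qed

section \<open>Edges, triangles and walks\<close>

lemma card_eq_sum_of_bool:
  assumes "finite X" "S \<subseteq> X"
  shows "real (card S) = (\<Sum>e\<in>X. of_bool (e \<in> S))"
  using assms by (simp add: sum_of_bool_eq Int_absorb1)

context graph
begin

lemma adj_sym: "u \<rightarrow>\<^bsub>G\<^esub> v \<longleftrightarrow> v \<rightarrow>\<^bsub>G\<^esub> u"
  using arcs_ends_symmetric[OF sym_arcs] by blast

lemma adj_neq: "u \<rightarrow>\<^bsub>G\<^esub> v \<Longrightarrow> u \<noteq> v"
  using adj_not_same by blast

lemma arcs_ends_subset: "arcs_ends G \<subseteq> verts G \<times> verts G"
  using adj_in_verts by auto

lemma finite_arcs_ends: "finite (arcs_ends G)"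
  by (simp add: arcs_ends_def)

definition adj :: "'a \<Rightarrow> 'a \<Rightarrow> real" where
  "adj u v = of_bool (u \<rightarrow>\<^bsub>G\<^esub> v)"

lemma adj_commute: "adj u v = adj v u"
  using adj_sym by (simp add: adj_def)

lemma card_arcs_ends: "card (arcs_ends G) = 2 * card (edges G)"
proof -
  let ?f = "\<lambda>(u, v). {u, v}"
  have im: "edges G = ?f ` arcs_ends G"
    by (auto simp: edges_def)
  have fib: "card {e \<in> arcs_ends G. ?f e = y} = 2" if y: "y \<in> edges G" for y
  proof -
    obtain u v where uv: "y = {u, v}" "u \<rightarrow>\<^bsub>G\<^esub> v"
      using y unfolding edges_def by blast
    then have "{e \<in> arcs_ends G. ?f e = y} = {(u, v), (v, u)}"
      using adj_sym by (auto simp: doubleton_eq_iff)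
    then show ?thesis
      using adj_neq[OF uv(2)] by simp
  qed
  have "card (arcs_ends G) = (\<Sum>y\<in>edges G. card {e \<in> arcs_ends G. ?f e = y})"
    using sum.group[OF finite_arcs_ends, of "edges G" ?f "\<lambda>_. 1::nat"] finite_arcs_ends
    by (simp add: im)
  with fib show ?thesis by simp
qed

text \<open>
  A closed walk of length three is a triangle with a starting point and an orientation, which
  accounts for the factor six in \<open>card_closed_3_walks\<close>.
\<close>

definition closed_3_walks :: "('a \<times> 'a \<times> 'a) set" where
  "closed_3_walks = {(u, v, w). u \<rightarrow>\<^bsub>G\<^esub> v \<and> v \<rightarrow>\<^bsub>G\<^esub> w \<and> u \<rightarrow>\<^bsub>G\<^esub> w}"

lemma closed_3_walks_subset: "closed_3_walks \<subseteq> verts G \<times> verts G \<times> verts G"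
  using adj_in_verts by (auto simp: closed_3_walks_def)

lemma finite_closed_3_walks: "finite closed_3_walks"
  using closed_3_walks_subset by (rule finite_subset) simp

lemma triangles_image: "triangles G = (\<lambda>(u, v, w). {u, v, w}) ` closed_3_walks"
  by (auto simp: triangles_def closed_3_walks_def image_def)

lemma finite_triangles: "finite (triangles G)"
  by (simp add: triangles_image finite_closed_3_walks)

lemma card_closed_3_walks: "card closed_3_walks = 6 * card (triangles G)"
proof -
  let ?f = "\<lambda>(u, v, w). {u, v, w}"
  have fib: "card {e \<in> closed_3_walks. ?f e = y} = 6" if y_tri: "y \<in> triangles G" for y
  proof -
    obtain a b c where y: "y = {a, b, c}" and adj: "a \<rightarrow>\<^bsub>G\<^esub> b" "b \<rightarrow>\<^bsub>G\<^esub> c" "a \<rightarrow>\<^bsub>G\<^esub> c"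
      using y_tri unfolding triangles_def by blast
    then have neq: "a \<noteq> b" "b \<noteq> c" "a \<noteq> c"
      using adj_neq by blast+
    have "{e \<in> closed_3_walks. ?f e = y} = {(a, b, c), (a, c, b), (b, a, c), (b, c, a), (c, a, b), (c, b, a)}"
      (is "?L = ?R")
    proof
      show "?L \<subseteq> ?R"
      proof
        fix e assume "e \<in> ?L"
        then obtain u v w where e: "e = (u, v, w)" "{u, v, w} = {a, b, c}" "u \<noteq> v" "v \<noteq> w" "u \<noteq> w"
          using adj_neq by (auto simp: closed_3_walks_def y)
        then have "u \<in> {a, b, c}" "v \<in> {a, b, c}" "w \<in> {a, b, c}" by blast+
        then show "e \<in> ?R" using e by auto
      qed
      show "?R \<subseteq> ?L"
        using adj adj_sym by (auto simp: closed_3_walks_def y)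
    qed
    then show ?thesis
      using neq by simp
  qed
  have "card closed_3_walks = (\<Sum>y\<in>triangles G. card {e \<in> closed_3_walks. ?f e = y})"
    using sum.group[OF finite_closed_3_walks finite_triangles, of ?f "\<lambda>_. 1::nat"]
    by (simp add: triangles_image)
  with fib show ?thesis by simp
qed


lemma verts_nonempty_of_edges:
  "1 \<le> card (edges G) \<Longrightarrow> verts G \<noteq> {}"
  using arcs_ends_subset by (auto simp: edges_def)

lemma delete_isolated_verts: "verts (delete_isolated G) = {v \<in> verts G. \<exists>u. v \<rightarrow>\<^bsub>G\<^esub> u}"
  by (simp add: delete_isolated_def)

lemma delete_isolated_arcs: "arcs (delete_isolated G) = arcs G"
proof -
  have "tail G e \<rightarrow>\<^bsub>G\<^esub> head G e" "head G e \<rightarrow>\<^bsub>G\<^esub> tail G e" if "e \<in> arcs G" for e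
    using that adj_sym by (auto simp: arcs_ends_conv)
  then show ?thesis
    by (auto simp: delete_isolated_def)
qed

lemma delete_isolated_arcs_ends: "arcs_ends (delete_isolated G) = arcs_ends G"
  by (simp add: arcs_ends_conv delete_isolated_arcs) (simp add: delete_isolated_def)

lemma graph_delete_isolated: "graph (delete_isolated G)"
proof -
  have "induced_subgraph (delete_isolated G) G"
    unfolding delete_isolated_def by (rule induced_induce) blast
  then have "digraph (delete_isolated G)"
    by (rule digraphI_induced)
  moreover have "symmetric (delete_isolated G)"
    using sym_arcs by (simp add: symmetric_def delete_isolated_arcs_ends)
  ultimately show ?thesis
    by (rule digraph.graphI)
qed

text \<open>
  Isolated vertices lie on no arc, so the adjacency relation alone decides whether a graph is
  complete bipartite up to them. Nonempty parts make every vertex of a part non-isolated.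
\<close>

lemma complete_bipartite_up_to_isolated_iff:
  "complete_bipartite_up_to_isolated G \<longleftrightarrow>
     (\<exists>U W. U \<inter> W = {} \<and> U \<noteq> {} \<and> W \<noteq> {} \<and> arcs_ends G = U \<times> W \<union> W \<times> U)" (is "?L \<longleftrightarrow> ?R")
proof
  assume ?L
  then obtain U W where "U \<inter> W = {}" "1 \<le> card U" "1 \<le> card W" "arcs_ends G = U \<times> W \<union> W \<times> U"
    unfolding complete_bipartite_up_to_isolated_def complete_bipartite_digraph_def
      delete_isolated_arcs_ends by blast
  moreover from this have "U \<noteq> {}" "W \<noteq> {}" by auto
  ultimately show ?R by blast
next
  assume ?R
  then obtain U W where disj: "U \<inter> W = {}" and ne: "U \<noteq> {}" "W \<noteq> {}"
    and ends: "arcs_ends G = U \<times> W \<union> W \<times> U" by blast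
  have sub: "U \<union> W \<subseteq> verts G"
    using arcs_ends_subset ne unfolding ends by blast
  then have verts: "verts (delete_isolated G) = U \<union> W"
    unfolding delete_isolated_verts ends using ne by blast
  have "finite (U \<union> W)"
    using sub by (rule finite_subset) simp
  then have "1 \<le> card U" "1 \<le> card W"
    using ne by (simp_all add: Suc_le_eq card_gt_0_iff)
  moreover have "K\<^bsub>card U,card W\<^esub> (delete_isolated G)"
    unfolding complete_bipartite_digraph_def
    unfolding verts delete_isolated_arcs_ends
    by (intro conjI exI[of _ U] exI[of _ W] graph_delete_isolated refl disj ends)
  ultimately show ?L
    unfolding complete_bipartite_up_to_isolated_def by blast
qed

lemma hs_norm_adj: "hs_inner (verts G) adj adj = 2 * real (card (edges G))"
proof -
  have "real (card (arcs_ends G)) = (\<Sum>e\<in>verts G \<times> verts G. of_bool (e \<in> arcs_ends G))"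
    by (rule card_eq_sum_of_bool) (use arcs_ends_subset in simp_all)
  also have "\<dots> = (\<Sum>u\<in>verts G. \<Sum>w\<in>verts G. adj u w * adj u w)"
    by (subst sum.cartesian_product) (intro sum.cong; auto simp: adj_def)
  finally show ?thesis
    by (simp add: hs_inner_def card_arcs_ends)
qed

lemma cube_trace_adj:
  "hs_inner (verts G) (kmult (verts G) adj adj) adj = 6 * real (card (triangles G))"
proof -
  let ?V = "verts G"
  have "real (card closed_3_walks) = (\<Sum>e\<in>?V \<times> ?V \<times> ?V. of_bool (e \<in> closed_3_walks))"
    by (rule card_eq_sum_of_bool) (use closed_3_walks_subset in simp_all)
  also have "\<dots> = (\<Sum>u\<in>?V. \<Sum>v\<in>?V. \<Sum>w\<in>?V. adj u v * adj v w * adj u w)"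
    by (simp only: sum.cartesian_product') (intro sum.cong refl; simp add: adj_def closed_3_walks_def)
  also have "\<dots> = (\<Sum>u\<in>?V. \<Sum>w\<in>?V. \<Sum>v\<in>?V. adj u v * adj v w * adj u w)"
    by (intro sum.cong sum.swap refl)
  finally show ?thesis
    by (simp add: hs_inner_def kmult_def sum_distrib_right card_closed_3_walks)
qed

lemma cube_adj:
  "kmult (verts G) adj (kmult (verts G) adj adj) u w
     = real (card {(v, v'). u \<rightarrow>\<^bsub>G\<^esub> v \<and> v \<rightarrow>\<^bsub>G\<^esub> v' \<and> v' \<rightarrow>\<^bsub>G\<^esub> w})"
    (is "_ = real (card ?P)")
proof -
  let ?V = "verts G"
  have "real (card ?P) = (\<Sum>e\<in>?V \<times> ?V. of_bool (e \<in> ?P))"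
    by (rule card_eq_sum_of_bool) (use adj_in_verts in auto)
  also have "\<dots> = (\<Sum>v\<in>?V. \<Sum>v'\<in>?V. adj u v * (adj v v' * adj v' w))"
    by (subst sum.cartesian_product) (intro sum.cong; auto simp: adj_def)
  finally show ?thesis
    by (simp add: kmult_def sum_distrib_left)
qed

section \<open>Triangle-free graphs whose cube is a multiple of the adjacency matrix\<close>

text \<open>
  Fix an edge \<open>ij\<close>. The set \<open>P\<close> of middle arcs of the three-step walks from \<open>i\<close> to \<open>j\<close> has \<open>m\<close>
  elements and is disjoint from its converse, because the neighbourhoods \<open>U\<close> of \<open>i\<close> and \<open>W\<close> of
  \<open>j\<close> have no common vertex. As there are \<open>2 m\<close> arcs, \<open>P\<close> and its converse exhaust them.
\<close>

lemma complete_bipartite_of_cube: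
  assumes no_tri: "triangles G = {}" and m: "1 \<le> card (edges G)"
    and cube: "\<And>u w. u \<in> verts G \<Longrightarrow> w \<in> verts G \<Longrightarrow>
      kmult (verts G) adj (kmult (verts G) adj adj) u w = real (card (edges G)) * adj u w"
  shows "complete_bipartite_up_to_isolated G"
proof -
  let ?m = "card (edges G)"
  have triangle_free: False if "u \<rightarrow>\<^bsub>G\<^esub> v" "v \<rightarrow>\<^bsub>G\<^esub> w" "u \<rightarrow>\<^bsub>G\<^esub> w" for u v w
    using no_tri that unfolding triangles_def by blast
  have walks: "real (card {(v, v'). u \<rightarrow>\<^bsub>G\<^esub> v \<and> v \<rightarrow>\<^bsub>G\<^esub> v' \<and> v' \<rightarrow>\<^bsub>G\<^esub> w}) = real ?m * adj u w"
    if "u \<in> verts G" "w \<in> verts G" for u w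
    using cube[OF that] by (simp add: cube_adj)
  obtain i j where ij: "i \<rightarrow>\<^bsub>G\<^esub> j"
    using m by (fastforce simp: edges_def)
  define U where "U = {v. i \<rightarrow>\<^bsub>G\<^esub> v}"
  define W where "W = {v. j \<rightarrow>\<^bsub>G\<^esub> v}"
  define P where "P = {(v, v'). i \<rightarrow>\<^bsub>G\<^esub> v \<and> v \<rightarrow>\<^bsub>G\<^esub> v' \<and> v' \<rightarrow>\<^bsub>G\<^esub> j}"
  have P_sub: "P \<subseteq> U \<times> W"
    using adj_sym by (auto simp: P_def U_def W_def)
  have P_ends: "P \<subseteq> arcs_ends G" "P\<inverse> \<subseteq> arcs_ends G"
    using adj_sym by (auto simp: P_def)
  have disj: "U \<inter> W = {}"
    using triangle_free[of i j] ij by (auto simp: U_def W_def)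
  have "real (card P) = real ?m * adj i j"
    unfolding P_def using adj_in_verts[OF ij] by (rule walks)
  then have "card P = ?m"
    using ij by (simp add: adj_def)
  moreover have "P \<inter> P\<inverse> = {}"
    using P_sub disj by blast
  moreover have "finite P"
    using P_ends(1) finite_arcs_ends by (rule finite_subset)
  ultimately have "card (P \<union> P\<inverse>) = card (arcs_ends G)"
    by (simp add: card_Un_disjoint card_arcs_ends)
  then have ends: "arcs_ends G = P \<union> P\<inverse>"
    using P_ends by (intro card_subset_eq[OF finite_arcs_ends, symmetric]) auto
  have complete: "u \<rightarrow>\<^bsub>G\<^esub> w" if u: "i \<rightarrow>\<^bsub>G\<^esub> u" and w: "j \<rightarrow>\<^bsub>G\<^esub> w" for u w
  proof -
    let ?Q = "{(v, v'). u \<rightarrow>\<^bsub>G\<^esub> v \<and> v \<rightarrow>\<^bsub>G\<^esub> v' \<and> v' \<rightarrow>\<^bsub>G\<^esub> w}"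
    (* the walk from u to i to j to w makes this entry of the cube nonzero *)
    have "(i, j) \<in> ?Q"
      using u w ij adj_sym[of i u] by simp
    moreover have "finite ?Q"
      by (rule finite_subset[OF _ finite_arcs_ends]) auto
    ultimately have "card ?Q \<noteq> 0"
      by auto
    then have "real ?m * adj u w \<noteq> 0"
      using walks[OF adj_in_verts(2)[OF u] adj_in_verts(2)[OF w]] by linarith
    then show ?thesis
      by (simp add: adj_def)
  qed
  have "arcs_ends G = U \<times> W \<union> W \<times> U"
  proof
    show "arcs_ends G \<subseteq> U \<times> W \<union> W \<times> U"
      unfolding ends using P_sub by blast
    show "U \<times> W \<union> W \<times> U \<subseteq> arcs_ends G"
      using complete adj_sym by (auto simp: U_def W_def)
  qed
  moreover have "U \<noteq> {}" "W \<noteq> {}"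
    using ij adj_sym[of i j] by (auto simp: U_def W_def)
  ultimately show ?thesis
    unfolding complete_bipartite_up_to_isolated_iff using disj by blast
qed

section \<open>Adjacency eigenvalues\<close>

definition adj_eigenvector :: "('a \<Rightarrow> real) \<Rightarrow> real \<Rightarrow> bool" where
  "adj_eigenvector x c \<longleftrightarrow> (\<exists>v\<in>verts G. x v \<noteq> 0) \<and>
     (\<forall>u\<in>verts G. (\<Sum>w\<in>verts G. adj u w * x w) = c * x u)"

lemma spectrum_adjacency_matrix:
  assumes "distinct vs" "set vs = verts G"
  shows "spectrum (adjacency_matrix G vs) = {c. \<exists>x. adj_eigenvector x c}"
proof -
  have "adjacency_matrix G vs = mat (length vs) (length vs) (\<lambda>(i, j). adj (vs ! i) (vs ! j))"
    by (simp add: adjacency_matrix_def adj_def of_bool_def)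
  then have "eigenvalue (adjacency_matrix G vs) c \<longleftrightarrow> (\<exists>x. adj_eigenvector x c)" for c
    using eigenvalue_indexed_mat_iff[OF assms(1), of adj c]
    unfolding adj_eigenvector_def assms(2) by simp
  then show ?thesis
    by (auto simp: spectrum_def)
qed

lemma largest_eigenvalue_adjacency_matrix:
  assumes "distinct vs" "set vs = verts G" "verts G \<noteq> {}"
  shows "\<exists>x. adj_eigenvector x (largest_eigenvalue (adjacency_matrix G vs))"
    and "adj_eigenvector y c \<Longrightarrow> c \<le> largest_eigenvalue (adjacency_matrix G vs)"
proof -
  let ?S = "spectrum (adjacency_matrix G vs)"
  have fin: "finite ?S"
    unfolding adjacency_matrix_def by (rule card_finite_spectrum(1)[OF mat_carrier])
  obtain c x where "\<exists>v\<in>verts G. x v \<noteq> 0"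
    "\<And>u. u \<in> verts G \<Longrightarrow> (\<Sum>w\<in>verts G. adj u w * x w) = c * x u"
    using adj_commute
    by (rule symmetric_eigenvalue_exists[where a = adj, OF finite_verts assms(3)]) (rule that)
  then have "c \<in> ?S"
    by (auto simp: spectrum_adjacency_matrix[OF assms(1,2)] adj_eigenvector_def)
  then have "Max ?S \<in> ?S"
    using fin by (intro Max_in) auto
  then show "\<exists>x. adj_eigenvector x (largest_eigenvalue (adjacency_matrix G vs))"
    unfolding largest_eigenvalue_def by (simp add: spectrum_adjacency_matrix[OF assms(1,2)])
  show "c \<le> largest_eigenvalue (adjacency_matrix G vs)" if "adj_eigenvector y c" for y c
    unfolding largest_eigenvalue_def using fin that
    by (intro Max_ge) (auto simp: spectrum_adjacency_matrix[OF assms(1,2)])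
qed

lemma adj_eigenvector_normalize:
  assumes "adj_eigenvector x c"
  obtains y where "unit_eigenvector (verts G) adj y c"
proof -
  define N where "N = (\<Sum>v\<in>verts G. (x v)\<^sup>2)"
  obtain v where "v \<in> verts G" "x v \<noteq> 0"
    using assms by (auto simp: adj_eigenvector_def)
  then have "0 < N"
    unfolding N_def by (intro sum_pos2[of _ v]) auto
  have "unit_eigenvector (verts G) adj (\<lambda>v. x v / sqrt N) c"
  proof
    show "(\<Sum>w\<in>verts G. adj u w * (x w / sqrt N)) = c * (x u / sqrt N)" if "u \<in> verts G" for u
      using assms that by (simp add: adj_eigenvector_def flip: sum_divide_distrib)
    show "(\<Sum>v\<in>verts G. (x v / sqrt N)\<^sup>2) = 1"
      using \<open>0 < N\<close> by (simp add: power_divide N_def flip: sum_divide_distrib)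
  qed (simp_all add: adj_commute)
  then show ?thesis by (rule that)
qed

section \<open>The triangle bound and its equality case\<close>

text \<open>
  For \<open>lam < 0\<close> the bound is negative. For \<open>lam \<ge> 0\<close> the estimates \<open>cube_trace_lower_bound\<close> and
  \<open>cubic_tangent\<close> are chained at \<open>r = sqrt m\<close>, so equality in the bound is equality in both.
\<close>

lemma triangle_count_lower_bound:
  assumes ev: "adj_eigenvector x lam" and edge: "1 \<le> card (edges G)"
  defines "m \<equiv> real (card (edges G))" and "t \<equiv> real (card (triangles G))"
  shows "m * (lam - sqrt m) \<le> t"
    and "t = m * (lam - sqrt m) \<Longrightarrow> complete_bipartite_up_to_isolated G"
proof -
  obtain y where "unit_eigenvector (verts G) adj y lam"
    using ev by (rule adj_eigenvector_normalize)
  then interpret unit_eigenvector "verts G" adj y lam .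
  have "0 < m" using assms by simp
  have goal: "m * (lam - sqrt m) \<le> t \<and> (t = m * (lam - sqrt m) \<longrightarrow> complete_bipartite_up_to_isolated G)"
  proof (cases "0 \<le> lam")
    case False
    then have "lam - sqrt m < 0"
      using real_sqrt_gt_zero[OF \<open>0 < m\<close>] by linarith
    then have "m * (lam - sqrt m) < 0"
      using \<open>0 < m\<close> by (rule mult_pos_neg[rotated])
    moreover have "0 \<le> t" by (simp add: t_def)
    ultimately show ?thesis by linarith
  next
    case True
    define s where "s = sqrt (2 * m - lam\<^sup>2)"
    have "0 \<le> 2 * m - lam\<^sup>2"
      using hs_inner_self_nonneg[of "verts G" deflated] by (simp add: hs_norm_deflated hs_norm_adj m_def)
    then have s: "0 \<le> s" "s\<^sup>2 = 2 * m - lam\<^sup>2"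
      by (simp_all add: s_def)
    have cube: "lam ^ 3 - s ^ 3 \<le> 6 * t"
      using cube_trace_lower_bound[OF s(1)] s(2) by (simp add: hs_norm_adj cube_trace_adj m_def t_def)
    have r: "0 < sqrt m" "2 * (sqrt m)\<^sup>2 = lam\<^sup>2 + s\<^sup>2"
      using \<open>0 < m\<close> s(2) by simp_all
    have tangent: "6 * m * (lam - sqrt m) \<le> lam ^ 3 - s ^ 3"
      and tangent_eq: "6 * m * (lam - sqrt m) = lam ^ 3 - s ^ 3 \<Longrightarrow> lam = s"
      using cubic_tangent[OF True s(1) r] \<open>0 < m\<close> by simp_all
    have "complete_bipartite_up_to_isolated G" if eq: "t = m * (lam - sqrt m)"
    proof -
      have "6 * m * (lam - sqrt m) = lam ^ 3 - s ^ 3"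
        using eq cube tangent by simp
      then have "lam = s"
        by (rule tangent_eq)
      then have lam_sq: "lam\<^sup>2 = m"
        using s(2) by simp
      then have "lam = sqrt m"
        using True by (metis real_sqrt_unique)
      then have "t = 0"
        using eq by simp
      show ?thesis
      proof (rule complete_bipartite_of_cube[OF _ edge])
        show "triangles G = {}"
          using \<open>t = 0\<close> finite_triangles by (simp add: t_def)
        show "kmult (verts G) adj (kmult (verts G) adj adj) u w = real (card (edges G)) * adj u w"
          if "u \<in> verts G" "w \<in> verts G" for u w
          using cube_of_extremal[OF True _ _ that] lam_sq \<open>t = 0\<close>
          by (simp add: hs_norm_adj cube_trace_adj m_def t_def)
      qed
    qed
    then show ?thesis
      using cube tangent by simp
  qed
  show "m * (lam - sqrt m) \<le> t"
    using goal by blast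
  show "complete_bipartite_up_to_isolated G" if "t = m * (lam - sqrt m)"
    using goal that by blast
qed

text \<open>
  The eigenvector is constant on each part and spreads the same squared norm over both parts, so its
  value on a part is, up to scaling, the square root of the size of the opposite part.
\<close>

lemma complete_bipartite_extremal:
  assumes "complete_bipartite_up_to_isolated G"
  shows "triangles G = {}" and "\<exists>x. adj_eigenvector x (sqrt (real (card (edges G))))"
proof -
  obtain U W where disj: "U \<inter> W = {}" and ne: "U \<noteq> {}" "W \<noteq> {}"
    and ends: "arcs_ends G = U \<times> W \<union> W \<times> U"
    using assms unfolding complete_bipartite_up_to_isolated_iff by blast
  show "triangles G = {}"
    using disj unfolding triangles_def ends by blast
  have sub: "U \<subseteq> verts G" "W \<subseteq> verts G"
    using arcs_ends_subset ne unfolding ends by blast+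
  then have fin: "finite U" "finite W"
    using finite_subset finite_verts by blast+
  have "card (arcs_ends G) = 2 * (card U * card W)"
    unfolding ends using fin disj
    by (subst card_Un_disjoint) (auto simp: card_cartesian_product)
  then have m: "card (edges G) = card U * card W"
    by (simp add: card_arcs_ends)
  define x where "x v = sqrt (real (card W)) * of_bool (v \<in> U) + sqrt (real (card U)) * of_bool (v \<in> W)" for v
  have row: "(\<Sum>w\<in>verts G. adj u w * x w) = (\<Sum>w\<in>N. x w)"
    if "N \<subseteq> verts G" "\<And>w. u \<rightarrow>\<^bsub>G\<^esub> w \<longleftrightarrow> w \<in> N" for u N
    using that by (intro sum.mono_neutral_cong_right) (auto simp: adj_def)
  have "(\<Sum>w\<in>verts G. adj u w * x w) = sqrt (real (card (edges G))) * x u" if "u \<in> verts G" for u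
  proof (cases "u \<in> U \<union> W")
    case False
    then have "(\<Sum>w\<in>verts G. adj u w * x w) = (\<Sum>w\<in>{}. x w)"
      by (intro row) (auto simp: ends)
    with False show ?thesis
      by (simp add: x_def)
  next
    case True
    then consider "u \<in> U" "u \<notin> W" | "u \<in> W" "u \<notin> U"
      using disj by blast
    then show ?thesis
    proof cases
      case 1
      then have "(\<Sum>w\<in>verts G. adj u w * x w) = (\<Sum>w\<in>W. x w)"
        by (intro row sub) (auto simp: ends)
      also have "\<dots> = (\<Sum>w\<in>W. sqrt (real (card U)))"
        using disj by (intro sum.cong) (auto simp: x_def)
      finally show ?thesis
        using 1 by (simp add: x_def m real_sqrt_mult)
    next
      case 2
      then have "(\<Sum>w\<in>verts G. adj u w * x w) = (\<Sum>w\<in>U. x w)"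
        by (intro row sub) (auto simp: ends)
      also have "\<dots> = (\<Sum>w\<in>U. sqrt (real (card W)))"
        using disj by (intro sum.cong) (auto simp: x_def)
      finally show ?thesis
        using 2 by (simp add: x_def m real_sqrt_mult)
    qed
  qed
  moreover have "\<exists>v\<in>verts G. x v \<noteq> 0"
  proof -
    obtain u where "u \<in> U" using ne by blast
    moreover from this have "u \<notin> W" using disj by blast
    ultimately have "x u \<noteq> 0"
      using fin ne by (simp add: x_def)
    with \<open>u \<in> U\<close> sub show ?thesis by blast
  qed
  ultimately show "\<exists>x. adj_eigenvector x (sqrt (real (card (edges G))))"
    unfolding adj_eigenvector_def by blast
qed

end

theorem theorem1p3:
  fixes G :: "('a, 'b) pre_digraph"
    and vs :: "'a list"
    and m :: nat
    and lam :: real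
  assumes "graph G"
    and "distinct vs" and "set vs = verts G"
    and "m = card (edges G)" and "m \<ge> 1"
    and "lam = largest_eigenvalue (adjacency_matrix G vs)"
  shows "real (card (triangles G)) \<ge> real m * (lam - sqrt (real m)) \<and>
    (real (card (triangles G)) = real m * (lam - sqrt (real m)) \<longleftrightarrow>
       complete_bipartite_up_to_isolated G)"
proof -
  interpret graph G by fact
  have m: "1 \<le> card (edges G)"
    using assms by simp
  note largest = largest_eigenvalue_adjacency_matrix[OF assms(2,3) verts_nonempty_of_edges[OF m],
      folded assms(6)]
  obtain x where x: "adj_eigenvector x lam"
    using largest(1) by blast
  note bound = triangle_count_lower_bound[OF x m, folded assms(4)]
  have "real (card (triangles G)) = real m * (lam - sqrt (real m))"
    if bip: "complete_bipartite_up_to_isolated G"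
  proof -
    have t: "triangles G = {}"
      using bip by (rule complete_bipartite_extremal)
    have "sqrt (real m) \<le> lam"
      using complete_bipartite_extremal(2)[OF bip] largest(2) unfolding assms(4) by blast
    then have "0 \<le> real m * (lam - sqrt (real m))"
      by simp
    then show ?thesis
      using bound(1) by (simp add: t)
  qed
  then show ?thesis
    using bound by blast
qed

end
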